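(* Let $\sigma\in(0,1]$. Then for every $c\in\Omega_\sigma$, $$\mathrm{Spec}(A_c)\subseteq\{\lambda\in\mathbf{C}:1-\sigma\le|\lambda|\le1+\sigma\}$$ and $$\mathrm{Spec}(A_c)\subseteq\Big\{x+iy:\ x,y\in\mathbf{R},\ |x|+|y|\le\sqrt{2(1+\sigma^2)}\Big\}.$$
   Context: $\Omega_\sigma=\{\pm\sigma\}^{\mathbf{Z}}$. For $c\in\Omega_\sigma$, $A_c$ is the bounded operator on $\ell^2(\mathbf{Z})$ given by $(A_cf)_n=c_nf_{n-1}+f_{n+1}$, and $\mathrm{Spec}(A_c)$ is its spectrum. *)

theory Defs
  imports "HOL-Analysis.Analysis"
begin

typedef 'a ell2 = "{f :: 'a \<Rightarrow> complex. (\<lambda>i. (cmod (f i))\<^sup>2) summable_on UNIV}"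
proof -
  have "(\<lambda>i::'a. (cmod 0)\<^sup>2) summable_on UNIV"
    by simp
  then show ?thesis
    by (intro exI[of _ "\<lambda>_. 0"]) simp
qed

setup_lifting type_definition_ell2

lemma ell2_eq_iff: "f = g \<longleftrightarrow> (\<forall>i. Rep_ell2 f i = Rep_ell2 g i)"
  by (metis Rep_ell2_inject ext)

lemma ell2_summable: "(\<lambda>i. (cmod (Rep_ell2 f i))\<^sup>2) summable_on UNIV"
  using Rep_ell2 by blast

lemma cmod_add_square_le: "(cmod (u + v))\<^sup>2 \<le> 2 * (cmod u)\<^sup>2 + 2 * (cmod v)\<^sup>2"
proof -
  have "(cmod (u + v))\<^sup>2 \<le> (cmod u + cmod v)\<^sup>2"
    by (intro power_mono norm_triangle_ineq norm_ge_zero)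
  also have "\<dots> \<le> 2 * (cmod u)\<^sup>2 + 2 * (cmod v)\<^sup>2"
    using zero_le_power2[of "cmod u - cmod v"] by (simp add: power2_eq_square algebra_simps)
  finally show ?thesis .
qed

lemma square_summable_add:
  assumes "(\<lambda>i. (cmod (f i))\<^sup>2) summable_on A" "(\<lambda>i. (cmod (g i))\<^sup>2) summable_on A"
  shows "(\<lambda>i. (cmod (f i + g i))\<^sup>2) summable_on A"
proof (rule summable_on_comparison_test)
  show "(\<lambda>i. 2 * (cmod (f i))\<^sup>2 + 2 * (cmod (g i))\<^sup>2) summable_on A"
    using assms by (intro summable_on_add summable_on_cmult_right)
  show "(cmod (f i + g i))\<^sup>2 \<le> 2 * (cmod (f i))\<^sup>2 + 2 * (cmod (g i))\<^sup>2" for i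
    by (rule cmod_add_square_le)
qed simp

lemma square_summable_mult:
  assumes "(\<lambda>i. (cmod (f i))\<^sup>2) summable_on A" "\<And>i. i \<in> A \<Longrightarrow> cmod (z i) \<le> K"
  shows "(\<lambda>i. (cmod (z i * f i))\<^sup>2) summable_on A"
proof (rule summable_on_comparison_test)
  show "(\<lambda>i. K\<^sup>2 * (cmod (f i))\<^sup>2) summable_on A"
    using assms by (intro summable_on_cmult_right)
  show "(cmod (z i * f i))\<^sup>2 \<le> K\<^sup>2 * (cmod (f i))\<^sup>2" if "i \<in> A" for i
    using assms(2)[OF that] by (simp add: norm_mult power_mult_distrib mult_right_mono power_mono)
qed simp

lemma square_summable_inner:
  fixes f g :: "'a \<Rightarrow> complex"
  assumes "(\<lambda>i. (cmod (f i))\<^sup>2) summable_on A" "(\<lambda>i. (cmod (g i))\<^sup>2) summable_on A"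
  shows "(\<lambda>i. inner (f i) (g i)) summable_on A"
proof -
  have "(\<lambda>i. norm (inner (f i) (g i))) summable_on A"
  proof (rule Infinite_Sum.abs_summable_on_comparison_test')
    show "(\<lambda>i. (cmod (f i))\<^sup>2 + (cmod (g i))\<^sup>2) summable_on A"
      using assms by (rule summable_on_add)
    show "norm (inner (f i) (g i)) \<le> (cmod (f i))\<^sup>2 + (cmod (g i))\<^sup>2" for i
    proof -
      have "norm (inner (f i) (g i)) \<le> cmod (f i) * cmod (g i)"
        by (simp add: Cauchy_Schwarz_ineq2)
      also have "\<dots> \<le> (cmod (f i))\<^sup>2 + (cmod (g i))\<^sup>2"
        using sum_squares_bound[of "cmod (f i)" "cmod (g i)"]
          mult_nonneg_nonneg[OF norm_ge_zero[of "f i"] norm_ge_zero[of "g i"]] by linarith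
      finally show ?thesis .
    qed
  qed
  then show ?thesis
    by (rule Infinite_Sum.abs_summable_summable)
qed

text \<open>
  The inner product supplied by the class \<^class>\<open>real_inner\<close> is the real part of the usual
  sesquilinear one; the norm is the usual \<open>\<ell>\<^sup>2\<close> norm (see \<open>norm_ell2\<close> below).
\<close>

instantiation ell2 :: (type) real_inner
begin

lift_definition zero_ell2 :: "'a ell2" is "\<lambda>_. 0"
  by simp

lift_definition plus_ell2 :: "'a ell2 \<Rightarrow> 'a ell2 \<Rightarrow> 'a ell2" is "\<lambda>f g i. f i + g i"
  by (rule square_summable_add)

lift_definition uminus_ell2 :: "'a ell2 \<Rightarrow> 'a ell2" is "\<lambda>f i. - f i"
  by simp

lift_definition minus_ell2 :: "'a ell2 \<Rightarrow> 'a ell2 \<Rightarrow> 'a ell2" is "\<lambda>f g i. f i - g i"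
proof -
  fix f g :: "'a \<Rightarrow> complex"
  assume "(\<lambda>i. (cmod (f i))\<^sup>2) summable_on UNIV" "(\<lambda>i. (cmod (g i))\<^sup>2) summable_on UNIV"
  then show "(\<lambda>i. (cmod (f i - g i))\<^sup>2) summable_on UNIV"
    using square_summable_add[of f UNIV "\<lambda>i. - g i"] by simp
qed

lift_definition scaleR_ell2 :: "real \<Rightarrow> 'a ell2 \<Rightarrow> 'a ell2" is "\<lambda>r f i. r *\<^sub>R f i"
  by (simp add: power_mult_distrib summable_on_cmult_right)

lift_definition inner_ell2 :: "'a ell2 \<Rightarrow> 'a ell2 \<Rightarrow> real" is "\<lambda>f g. \<Sum>\<^sub>\<infinity>i. inner (f i) (g i)" .

definition norm_ell2_def: "norm (f :: 'a ell2) = sqrt (inner f f)"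

definition dist_ell2_def: "dist (f :: 'a ell2) g = norm (f - g)"

definition sgn_ell2_def: "sgn (f :: 'a ell2) = inverse (norm f) *\<^sub>R f"

definition uniformity_ell2_def:
  "(uniformity :: ('a ell2 \<times> 'a ell2) filter) = (INF e\<in>{0<..}. principal {(x, y). dist x y < e})"

definition open_ell2_def:
  "open (U :: 'a ell2 set) \<longleftrightarrow> (\<forall>x\<in>U. eventually (\<lambda>(x', y). x' = x \<longrightarrow> y \<in> U) uniformity)"

instance
proof
  fix f g h :: "'a ell2" and r s :: real
  show "f + g + h = f + (g + h)" "f + g = g + f" "0 + f = f" "- f + f = 0" "f - g = f + - g"
    by (transfer; simp add: fun_eq_iff algebra_simps)+
  show "r *\<^sub>R (f + g) = r *\<^sub>R f + r *\<^sub>R g" "(r + s) *\<^sub>R f = r *\<^sub>R f + s *\<^sub>R f"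
    "r *\<^sub>R s *\<^sub>R f = (r * s) *\<^sub>R f" "1 *\<^sub>R f = f"
    by (transfer; simp add: fun_eq_iff algebra_simps)+
  show "inner f g = inner g f"
    by transfer (simp add: inner_commute)
  show "inner (f + g) h = inner f h + inner g h"
    by transfer (simp add: inner_add_left infsum_add square_summable_inner)
  show "inner (r *\<^sub>R f) g = r * inner f g"
    by transfer (simp add: infsum_cmult_right')
  show "0 \<le> inner f f"
    by transfer (simp add: infsum_nonneg)
  show "inner f f = 0 \<longleftrightarrow> f = 0"
  proof
    assume "inner f f = 0"
    then show "f = 0"
    proof transfer
      fix f :: "'a \<Rightarrow> complex"
      assume *: "(\<lambda>i. (cmod (f i))\<^sup>2) summable_on UNIV" "(\<Sum>\<^sub>\<infinity>i. inner (f i) (f i)) = 0"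
      have "inner (f i) (f i) = 0" for i
        by (rule nonneg_infsum_le_0D[where A = UNIV and f = "\<lambda>i. inner (f i) (f i)"])
          (use * in \<open>auto intro: square_summable_inner\<close>)
      then show "f = (\<lambda>_. 0)"
        by auto
    qed
  qed (transfer, simp)
qed (simp_all add: norm_ell2_def dist_ell2_def sgn_ell2_def uniformity_ell2_def open_ell2_def)

end

lemma norm_ell2: "norm f = sqrt (\<Sum>\<^sub>\<infinity>i. (cmod (Rep_ell2 f i))\<^sup>2)"
  by (simp add: norm_ell2_def inner_ell2.rep_eq power2_norm_eq_inner)

lift_definition scaleC :: "complex \<Rightarrow> 'a ell2 \<Rightarrow> 'a ell2" (infixr "*\<^sub>C" 75)
  is "\<lambda>z f i. z * f i"
  by (rule square_summable_mult) auto

definition bounded_clinear :: "('a ell2 \<Rightarrow> 'b ell2) \<Rightarrow> bool"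
  where "bounded_clinear T \<longleftrightarrow> bounded_linear T \<and> (\<forall>z f. T (z *\<^sub>C f) = z *\<^sub>C T f)"

definition spectrum :: "('a ell2 \<Rightarrow> 'a ell2) \<Rightarrow> complex set"
  where "spectrum T = {z. \<not> (\<exists>R. bounded_clinear R \<and>
    (\<forall>f. R (T f - z *\<^sub>C f) = f) \<and> (\<forall>f. T (R f) - z *\<^sub>C R f = f))}"

definition Omega :: "real \<Rightarrow> (int \<Rightarrow> real) set"
  where "Omega \<sigma> = {c. \<forall>n. c n = \<sigma> \<or> c n = - \<sigma>}"

text \<open>
  \<open>Abs_ell2\<close> is unspecified outside the square-summable families, so \<open>hop_op c\<close> is meaningful
  only for bounded \<open>c\<close>, in particular for \<open>c\<close> in \<^term>\<open>Omega \<sigma>\<close> (see \<open>Rep_hop_op\<close>).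
\<close>

definition hop_op :: "(int \<Rightarrow> real) \<Rightarrow> int ell2 \<Rightarrow> int ell2"
  where "hop_op c f =
    Abs_ell2 (\<lambda>n. complex_of_real (c n) * Rep_ell2 f (n - 1) + Rep_ell2 f (n + 1))"

lemma
  fixes f :: "int ell2" and k :: int
  shows summable_shift: "(\<lambda>n. (cmod (Rep_ell2 f (n + k)))\<^sup>2) summable_on UNIV"
    and infsum_shift: "(\<Sum>\<^sub>\<infinity>n. (cmod (Rep_ell2 f (n + k)))\<^sup>2) = (norm f)\<^sup>2"
proof -
  have bij: "bij_betw (\<lambda>n. n + k) UNIV UNIV"
    by (rule bij_betwI[where g = "\<lambda>n. n - k"]) auto
  show "(\<lambda>n. (cmod (Rep_ell2 f (n + k)))\<^sup>2) summable_on UNIV"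
    using summable_on_reindex_bij_betw[OF bij, of "\<lambda>n. (cmod (Rep_ell2 f n))\<^sup>2"]
    by (simp add: ell2_summable)
  show "(\<Sum>\<^sub>\<infinity>n. (cmod (Rep_ell2 f (n + k)))\<^sup>2) = (norm f)\<^sup>2"
    using infsum_reindex_bij_betw[OF bij, of "\<lambda>n. (cmod (Rep_ell2 f n))\<^sup>2"]
    by (simp add: norm_ell2 infsum_nonneg)
qed

lemma Rep_hop_op:
  assumes "c \<in> Omega \<sigma>"
  shows "Rep_ell2 (hop_op c f) n = complex_of_real (c n) * Rep_ell2 f (n - 1) + Rep_ell2 f (n + 1)"
proof -
  have "cmod (complex_of_real (c i)) \<le> \<bar>\<sigma>\<bar>" for i
    using assms by (auto simp: Omega_def dest!: spec[of _ i])
  then have "(\<lambda>n. (cmod (complex_of_real (c n) * Rep_ell2 f (n - 1) + Rep_ell2 f (n + 1)))\<^sup>2)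
      summable_on UNIV"
    using summable_shift[of f "-1"] summable_shift[of f 1]
    by (intro square_summable_add square_summable_mult) auto
  then show ?thesis
    by (simp add: hop_op_def Abs_ell2_inverse)
qed

lemma bounded_clinear_hop_op:
  assumes "c \<in> Omega \<sigma>"
  shows "bounded_clinear (hop_op c)"
  unfolding bounded_clinear_def
proof (intro conjI allI)
  show "hop_op c (z *\<^sub>C f) = z *\<^sub>C hop_op c f" for z f
    by (simp add: ell2_eq_iff Rep_hop_op[OF assms] scaleC.rep_eq algebra_simps)
  show "bounded_linear (hop_op c)"
  proof (rule bounded_linear_intro[where K = "sqrt (2 * \<sigma>\<^sup>2 + 2)"])
    show "hop_op c (f + g) = hop_op c f + hop_op c g" for f g
      by (simp add: ell2_eq_iff Rep_hop_op[OF assms] plus_ell2.rep_eq algebra_simps)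
    show "hop_op c (r *\<^sub>R f) = r *\<^sub>R hop_op c f" for r f
      by (simp add: ell2_eq_iff Rep_hop_op[OF assms] scaleR_ell2.rep_eq algebra_simps)
    show "norm (hop_op c f) \<le> norm f * sqrt (2 * \<sigma>\<^sup>2 + 2)" for f
    proof -
      let ?a = "\<lambda>n. (cmod (Rep_ell2 f (n + - 1)))\<^sup>2" and ?b = "\<lambda>n. (cmod (Rep_ell2 f (n + 1)))\<^sup>2"
      have le: "(cmod (Rep_ell2 (hop_op c f) n))\<^sup>2 \<le> 2 * \<sigma>\<^sup>2 * ?a n + 2 * ?b n" for n
      proof -
        have "(c n)\<^sup>2 = \<sigma>\<^sup>2"
          using assms by (auto simp: Omega_def dest!: spec[of _ n])
        then show ?thesis
          using cmod_add_square_le[of "complex_of_real (c n) * Rep_ell2 f (n - 1)" "Rep_ell2 f (n + 1)"]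
          by (simp add: Rep_hop_op[OF assms] norm_mult power_mult_distrib)
      qed
      have "(\<Sum>\<^sub>\<infinity>n. (cmod (Rep_ell2 (hop_op c f) n))\<^sup>2) \<le> (\<Sum>\<^sub>\<infinity>n. 2 * \<sigma>\<^sup>2 * ?a n + 2 * ?b n)"
        by (intro infsum_mono le ell2_summable summable_on_add summable_on_cmult_right summable_shift)
      also have "\<dots> = (2 * \<sigma>\<^sup>2 + 2) * (norm f)\<^sup>2"
        using summable_shift[of f "-1"] summable_shift[of f 1] infsum_shift[of f "-1"] infsum_shift[of f 1]
        by (simp add: infsum_add summable_on_cmult_right infsum_cmult_right' algebra_simps)
      finally have "norm (hop_op c f) \<le> sqrt ((2 * \<sigma>\<^sup>2 + 2) * (norm f)\<^sup>2)"
        by (simp add: norm_ell2[of "hop_op c f"])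
      then show ?thesis
        by (simp add: real_sqrt_mult mult.commute)
    qed
  qed
qed

end

theory Submission
  imports Defs
begin

text \<open>
  Write \<open>A\<close> for \<open>hop_op c\<close>. It is the unitary shift \<open>U\<close>, given by \<open>(U f) n = f (n + 1)\<close>, plus an
  operator \<open>D\<close> of norm at most \<open>\<sigma>\<close>, because every \<open>c n\<close> has absolute value \<open>\<sigma>\<close>.

  The annulus comes from this splitting by Neumann series. If \<open>\<bar>z\<bar> > 1 + \<sigma>\<close>, then \<open>\<bar>z\<bar>\<close> exceeds
  the norm of \<open>A\<close>. If \<open>\<bar>z\<bar> < 1 - \<sigma>\<close>, then \<open>A - z = U (1 + U\<^sup>*(D - z))\<close> and \<open>U\<^sup>*(D - z)\<close> has norm at
  most \<open>\<sigma> + \<bar>z\<bar> < 1\<close>.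

  The square comes from the numerical range. The form \<open>\<langle>A f, f\<rangle>\<close> is the sum over \<open>n\<close> of
  \<open>c\<^sub>n w\<^sub>n + cnj w\<^sub>n\<close>, where \<open>w\<^sub>n = f (n - 1) cnj (f n)\<close>. The real and the imaginary part of such a
  term are \<open>(1 + c\<^sub>n) Re w\<^sub>n\<close> and \<open>(c\<^sub>n - 1) Im w\<^sub>n\<close>, so their absolute values add up to at most
  \<open>\<surd>(2 (1 + \<sigma>\<^sup>2)) \<bar>w\<^sub>n\<bar>\<close> (\<open>bond_form_le\<close>), and the sum of the \<open>\<bar>w\<^sub>n\<bar>\<close> is at most \<open>\<parallel>f\<parallel>\<^sup>2\<close>. A point
  outside the square is thus separated from the numerical range by the line through one of the
  sides.

  Both parts need that an operator with these properties is invertible, not just bounded below.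
  This rests on Banach's fixed point theorem, hence on the completeness of \<open>\<ell>\<^sup>2\<close>. The common
  criterion is \<open>not_in_spectrum_if_approx_inverse\<close>; its coercive version
  \<open>not_in_spectrum_if_coercive\<close> serves the numerical range.
\<close>

section \<open>Completeness of the space of square-summable families\<close>

lemma norm_ell2_power2: "(norm f)\<^sup>2 = (\<Sum>\<^sub>\<infinity>i. (cmod (Rep_ell2 f i))\<^sup>2)"
  by (simp add: norm_ell2 infsum_nonneg)

lemma sum_le_norm_ell2_power2:
  assumes "finite F"
  shows "(\<Sum>i\<in>F. (cmod (Rep_ell2 f i))\<^sup>2) \<le> (norm f)\<^sup>2"
  unfolding norm_ell2_power2
  by (rule finite_sum_le_infsum) (use assms ell2_summable in auto)

lemma norm_ell2_le:
  assumes "0 \<le> B" "\<And>F. finite F \<Longrightarrow> (\<Sum>i\<in>F. (cmod (Rep_ell2 f i))\<^sup>2) \<le> B\<^sup>2"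
  shows "norm f \<le> B"
proof -
  have "(norm f)\<^sup>2 \<le> B\<^sup>2"
    unfolding norm_ell2_power2
    by (rule infsum_le_finite_sums) (use assms ell2_summable in auto)
  with assms(1) show ?thesis
    by (rule power2_le_imp_le[rotated])
qed

lemma cmod_Rep_ell2_le_norm: "cmod (Rep_ell2 f i) \<le> norm f"
proof (rule power2_le_imp_le)
  show "(cmod (Rep_ell2 f i))\<^sup>2 \<le> (norm f)\<^sup>2"
    using sum_le_norm_ell2_power2[of "{i}" f] by simp
qed simp

lemma norm_ell2_le_pointwise:
  assumes "0 \<le> K" "\<And>i. cmod (Rep_ell2 f i) \<le> K * cmod (Rep_ell2 g i)"
  shows "norm f \<le> K * norm g"
proof (rule norm_ell2_le)
  fix F :: "'a set"
  assume "finite F"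
  have "(\<Sum>i\<in>F. (cmod (Rep_ell2 f i))\<^sup>2) \<le> (\<Sum>i\<in>F. K\<^sup>2 * (cmod (Rep_ell2 g i))\<^sup>2)"
    by (intro sum_mono) (metis assms(2) norm_ge_zero power_mono power_mult_distrib)
  also have "\<dots> \<le> (K * norm g)\<^sup>2"
    using sum_le_norm_ell2_power2[OF \<open>finite F\<close>, of g]
    by (simp add: power_mult_distrib mult_left_mono flip: sum_distrib_left)
  finally show "(\<Sum>i\<in>F. (cmod (Rep_ell2 f i))\<^sup>2) \<le> (K * norm g)\<^sup>2" .
qed (use assms in simp)

lemma Rep_ell2_diff: "Rep_ell2 (f - g) i = Rep_ell2 f i - Rep_ell2 g i"
  by (simp add: minus_ell2.rep_eq)

text \<open>
  The pointwise limit of a Cauchy sequence is its limit in norm: on a finite index set the Cauchy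
  estimate survives the passage to the limit, and it is uniform in that set.
\<close>

lemma convergent_Cauchy_ell2:
  fixes X :: "nat \<Rightarrow> 'a ell2"
  assumes "Cauchy X"
  shows "convergent X"
proof -
  have "Cauchy (\<lambda>n. Rep_ell2 (X n) i)" for i
  proof (rule CauchyI)
    fix e :: real
    assume "0 < e"
    then obtain N where "\<And>m n. N \<le> m \<Longrightarrow> N \<le> n \<Longrightarrow> norm (X m - X n) < e"
      using CauchyD[OF assms] by blast
    then show "\<exists>N. \<forall>m\<ge>N. \<forall>n\<ge>N. cmod (Rep_ell2 (X m) i - Rep_ell2 (X n) i) < e"
      by (metis Rep_ell2_diff cmod_Rep_ell2_le_norm order_le_less_trans)
  qed
  then obtain g where g: "\<And>i. (\<lambda>n. Rep_ell2 (X n) i) \<longlonglongrightarrow> g i"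
    unfolding Cauchy_convergent_iff convergent_def by metis
  have tail: "\<exists>N. \<forall>n\<ge>N. \<forall>F. finite F \<longrightarrow> (\<Sum>i\<in>F. (cmod (Rep_ell2 (X n) i - g i))\<^sup>2) \<le> e\<^sup>2"
    if e: "0 < e" for e :: real
  proof -
    obtain N where N: "\<And>m n. N \<le> m \<Longrightarrow> N \<le> n \<Longrightarrow> norm (X m - X n) < e"
      using CauchyD[OF assms e] by blast
    have "(\<Sum>i\<in>F. (cmod (Rep_ell2 (X n) i - g i))\<^sup>2) \<le> e\<^sup>2" if "N \<le> n" "finite F" for n F
    proof (rule tendsto_upperbound)
      show "(\<lambda>m. \<Sum>i\<in>F. (cmod (Rep_ell2 (X n) i - Rep_ell2 (X m) i))\<^sup>2)
          \<longlonglongrightarrow> (\<Sum>i\<in>F. (cmod (Rep_ell2 (X n) i - g i))\<^sup>2)"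
        by (intro tendsto_intros g)
      have "(\<Sum>i\<in>F. (cmod (Rep_ell2 (X n) i - Rep_ell2 (X m) i))\<^sup>2) \<le> e\<^sup>2" if "N \<le> m" for m
      proof -
        have "(norm (X n - X m))\<^sup>2 \<le> e\<^sup>2"
          using N[OF \<open>N \<le> n\<close> that] by (intro power_mono) auto
        then show ?thesis
          using sum_le_norm_ell2_power2[OF \<open>finite F\<close>, of "X n - X m"] by (simp add: Rep_ell2_diff)
      qed
      then show "\<forall>\<^sub>F m in sequentially.
          (\<Sum>i\<in>F. (cmod (Rep_ell2 (X n) i - Rep_ell2 (X m) i))\<^sup>2) \<le> e\<^sup>2"
        unfolding eventually_sequentially by blast
    qed simp
    then show ?thesis
      by blast
  qed
  obtain N where N: "\<And>F. finite F \<Longrightarrow> (\<Sum>i\<in>F. (cmod (Rep_ell2 (X N) i - g i))\<^sup>2) \<le> 1\<^sup>2"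
    using tail[of 1] by auto
  have diff: "(\<lambda>i. (cmod (- (Rep_ell2 (X N) i - g i)))\<^sup>2) summable_on UNIV"
    unfolding norm_minus_cancel
    by (rule nonneg_bdd_above_summable_on) (use N in \<open>auto intro!: bdd_aboveI2[where M = 1]\<close>)
  have "(\<lambda>i. (cmod (g i))\<^sup>2) summable_on UNIV"
    using square_summable_add[OF ell2_summable[of "X N"] diff] by simp
  then have G: "Rep_ell2 (Abs_ell2 g) = g"
    by (simp add: Abs_ell2_inverse)
  have "X \<longlonglongrightarrow> Abs_ell2 g"
  proof (rule LIMSEQ_I)
    fix e :: real
    assume "0 < e"
    then obtain M where "\<And>n F. M \<le> n \<Longrightarrow> finite F \<Longrightarrow>
        (\<Sum>i\<in>F. (cmod (Rep_ell2 (X n) i - g i))\<^sup>2) \<le> (e / 2)\<^sup>2"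
      using tail[of "e / 2"] by auto
    then have le: "norm (X n - Abs_ell2 g) \<le> e / 2" if "M \<le> n" for n
      using that \<open>0 < e\<close> by (intro norm_ell2_le) (simp_all add: Rep_ell2_diff G)
    have "norm (X n - Abs_ell2 g) < e" if "M \<le> n" for n
      using le[OF that] \<open>0 < e\<close> by linarith
    then show "\<exists>no. \<forall>n\<ge>no. norm (X n - Abs_ell2 g) < e"
      by blast
  qed
  then show ?thesis
    by (rule convergentI)
qed

instance ell2 :: (type) complete_space
  by standard (rule convergent_Cauchy_ell2)

section \<open>Criteria for a point to lie outside the spectrum\<close>

lemma scaleC_add_right: "z *\<^sub>C (f + g) = z *\<^sub>C f + z *\<^sub>C g"
  by (simp add: ell2_eq_iff scaleC.rep_eq plus_ell2.rep_eq algebra_simps)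

lemma scaleC_diff_right: "z *\<^sub>C (f - g) = z *\<^sub>C f - z *\<^sub>C g"
  by (simp add: ell2_eq_iff scaleC.rep_eq minus_ell2.rep_eq algebra_simps)

lemma scaleC_scaleC: "z *\<^sub>C w *\<^sub>C f = (z * w) *\<^sub>C f"
  by (simp add: ell2_eq_iff scaleC.rep_eq)

lemma scaleR_eq_scaleC: "r *\<^sub>R f = complex_of_real r *\<^sub>C f"
  by (simp add: ell2_eq_iff scaleC.rep_eq scaleR_ell2.rep_eq scaleR_conv_of_real)

lemma one_scaleC: "1 *\<^sub>C f = f"
  by (simp add: ell2_eq_iff scaleC.rep_eq)

lemma norm_scaleC: "norm (z *\<^sub>C f) = cmod z * norm f"
  by (simp add: norm_ell2 scaleC.rep_eq norm_mult power_mult_distrib infsum_cmult_right'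
      real_sqrt_mult)

lemma bounded_linear_scaleC: "bounded_linear (\<lambda>f. z *\<^sub>C f)"
proof (rule bounded_linear_intro[where K = "cmod z"])
  show "z *\<^sub>C (r *\<^sub>R f) = r *\<^sub>R z *\<^sub>C f" for r and f :: "'b ell2"
    by (simp add: scaleR_eq_scaleC scaleC_scaleC mult.commute)
qed (simp_all add: scaleC_add_right norm_scaleC mult.commute)

lemma inj_scaleC:
  assumes "z \<noteq> 0"
  shows "inj (\<lambda>f. z *\<^sub>C f)"
  by (rule inj_on_inverseI[where g = "\<lambda>f. inverse z *\<^sub>C f"])
    (use assms in \<open>simp add: scaleC_scaleC one_scaleC\<close>)

text \<open>
  An approximate left inverse \<open>W\<close> suffices. For fixed \<open>g\<close> the map
  \<open>f \<mapsto> W g + (f - W (T f - z f))\<close> is a contraction, and as \<open>W\<close> is injective its fixed points are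
  exactly the solutions of \<open>T f - z f = g\<close>. So there is one and only one solution, which makes the
  resolvent linear; it is bounded because \<open>(1 - q) \<parallel>f\<parallel> \<le> \<parallel>W g\<parallel>\<close>.
\<close>

lemma not_in_spectrum_if_approx_inverse:
  assumes T: "bounded_clinear T" and W: "bounded_linear W" "inj W" and "q < 1"
    and approx: "\<And>f. norm (f - W (T f - z *\<^sub>C f)) \<le> q * norm f"
  shows "z \<notin> spectrum T"
proof -
  interpret T: bounded_linear T
    using T by (simp add: bounded_clinear_def)
  interpret W: bounded_linear W
    by (rule W)
  define B where "B f = T f - z *\<^sub>C f" for f
  have B_add: "B (f + g) = B f + B g" for f g
    by (simp add: B_def T.add scaleC_add_right)
  have B_diff: "B (f - g) = B f - B g" for f g
    by (simp add: B_def T.diff scaleC_diff_right)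
  have B_scaleC: "B (w *\<^sub>C f) = w *\<^sub>C B f" for w f
    using T by (simp add: B_def bounded_clinear_def scaleC_diff_right scaleC_scaleC mult.commute)
  have approx: "norm (f - W (B f)) \<le> q * norm f" for f
    using assms(5) by (simp add: B_def)
  have "\<exists>!f. B f = g" for g
  proof -
    let ?\<Phi> = "\<lambda>f. W g + (f - W (B f))"
    have "\<exists>!f. ?\<Phi> f = f"
    proof (rule banach_fix_type[where c = "max 0 q"])
      show "\<forall>f h. dist (?\<Phi> f) (?\<Phi> h) \<le> max 0 q * dist f h"
      proof (intro allI)
        fix f h
        have "dist (?\<Phi> f) (?\<Phi> h) = norm (f - h - W (B (f - h)))"
          by (simp add: dist_norm B_diff W.diff algebra_simps)
        also have "\<dots> \<le> max 0 q * norm (f - h)"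
          by (rule order_trans[OF approx]) (simp add: mult_right_mono)
        finally show "dist (?\<Phi> f) (?\<Phi> h) \<le> max 0 q * dist f h"
          by (simp add: dist_norm)
      qed
    qed (use \<open>q < 1\<close> in auto)
    moreover have "?\<Phi> f = f \<longleftrightarrow> B f = g" for f
      using injD[OF W(2), of "B f" g] by (auto simp: algebra_simps)
    ultimately show ?thesis
      by simp
  qed
  then obtain R where R: "\<And>g. B (R g) = g" and R_eqI: "\<And>f g. B f = g \<Longrightarrow> R g = f"
    by metis
  have scaleC_R: "R (w *\<^sub>C g) = w *\<^sub>C R g" for w g
    by (rule R_eqI) (simp add: B_scaleC R)
  have "bounded_linear R"
  proof (rule bounded_linear_intro)
    show "R (f + g) = R f + R g" for f g
      by (rule R_eqI) (simp add: B_add R)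
    show "R (r *\<^sub>R g) = r *\<^sub>R R g" for r g
      by (simp add: scaleR_eq_scaleC scaleC_R)
    show "norm (R g) \<le> norm g * (onorm W / (1 - q))" for g
    proof -
      have "norm (R g) \<le> norm (R g - W g) + norm (W g)"
        using norm_triangle_ineq[of "R g - W g" "W g"] by simp
      also have "\<dots> \<le> q * norm (R g) + onorm W * norm g"
        using approx[of "R g"] onorm[OF W(1), of g] by (simp add: R)
      finally show ?thesis
        using \<open>q < 1\<close> by (simp add: field_simps)
    qed
  qed
  then have "bounded_clinear R"
    by (simp add: bounded_clinear_def scaleC_R)
  then have "\<exists>R. bounded_clinear R \<and> (\<forall>f. R (B f) = f) \<and> (\<forall>f. B (R f) = f)"
    using R R_eqI by blast
  then show ?thesis
    by (simp add: spectrum_def B_def)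
qed

text \<open>
  This is the Lax-Milgram argument, in the form ``the spectrum lies in every closed half-plane that
  contains the numerical range'': if \<open>B = u (z - T)\<close> is coercive
  with constant \<open>d\<close> and has norm at most \<open>K\<close>, then
  \<open>\<parallel>f - t B f\<parallel>\<^sup>2 \<le> (1 - 2 t d + t\<^sup>2 K\<^sup>2) \<parallel>f\<parallel>\<^sup>2\<close>, and the factor is less than \<open>1\<close> for small \<open>t > 0\<close>.
\<close>

lemma not_in_spectrum_if_coercive:
  assumes T: "bounded_clinear T" and "0 < d"
    and coercive: "\<And>f. d * (norm f)\<^sup>2 \<le> inner (u *\<^sub>C (z *\<^sub>C f - T f)) f"
    and "u \<noteq> 0"
  shows "z \<notin> spectrum T"
proof -
  have "bounded_linear T"
    using T by (simp add: bounded_clinear_def)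
  then have "bounded_linear (\<lambda>f. u *\<^sub>C (z *\<^sub>C f - T f))"
    by (intro bounded_linear_compose[OF bounded_linear_scaleC] bounded_linear_sub
        bounded_linear_scaleC)
  then obtain K where "0 < K" and K: "\<And>f. norm (u *\<^sub>C (z *\<^sub>C f - T f)) \<le> norm f * K"
    using bounded_linear.pos_bounded by blast
  \<comment> \<open>the minimiser of \<open>1 - 2 t d + t\<^sup>2 K\<^sup>2\<close>, with minimum \<open>1 - d\<^sup>2 / K\<^sup>2\<close>\<close>
  define t where "t = d / K\<^sup>2"
  have "0 < t"
    using \<open>0 < d\<close> \<open>0 < K\<close> by (simp add: t_def)
  define p where "p = max 0 (1 - d\<^sup>2 / K\<^sup>2)"
  have "p < 1"
    using \<open>0 < d\<close> \<open>0 < K\<close> by (simp add: p_def)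
  show ?thesis
  proof (rule not_in_spectrum_if_approx_inverse[OF T])
    show "bounded_linear (\<lambda>f. (- (complex_of_real t * u)) *\<^sub>C f)"
      by (rule bounded_linear_scaleC)
    show "inj (\<lambda>f. (- (complex_of_real t * u)) *\<^sub>C f)"
      by (rule inj_scaleC) (use \<open>u \<noteq> 0\<close> \<open>0 < t\<close> in simp)
    show "sqrt p < 1"
      using \<open>p < 1\<close> by simp
    fix f
    define b where "b = u *\<^sub>C (z *\<^sub>C f - T f)"
    have b: "(- (complex_of_real t * u)) *\<^sub>C (T f - z *\<^sub>C f) = t *\<^sub>R b"
      by (simp add: b_def ell2_eq_iff scaleC.rep_eq scaleR_ell2.rep_eq minus_ell2.rep_eq
          scaleR_conv_of_real algebra_simps)
    have "(norm (f - t *\<^sub>R b))\<^sup>2 = (norm f)\<^sup>2 - 2 * t * inner b f + t\<^sup>2 * (norm b)\<^sup>2"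
      unfolding power2_norm_eq_inner
      by (simp add: inner_diff_left inner_diff_right inner_commute[of f b]
          power2_eq_square algebra_simps)
    also have "\<dots> \<le> (norm f)\<^sup>2 - 2 * t * (d * (norm f)\<^sup>2) + t\<^sup>2 * (norm f * K)\<^sup>2"
      using coercive[of f] K[of f] \<open>0 < t\<close> unfolding b_def[symmetric]
      by (intro add_mono diff_mono mult_left_mono power_mono) auto
    also have "\<dots> = (1 - d\<^sup>2 / K\<^sup>2) * (norm f)\<^sup>2"
      using \<open>0 < K\<close> by (simp add: t_def power2_eq_square field_simps)
    also have "\<dots> \<le> p * (norm f)\<^sup>2"
      by (intro mult_right_mono) (simp_all add: p_def)
    finally have "norm (f - t *\<^sub>R b) \<le> sqrt (p * (norm f)\<^sup>2)"
      by (rule real_le_rsqrt)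
    then show "norm (f - (- (complex_of_real t * u)) *\<^sub>C (T f - z *\<^sub>C f)) \<le> sqrt p * norm f"
      by (simp add: b real_sqrt_mult)
  qed
qed

section \<open>The hopping operator\<close>

lift_definition shift :: "int \<Rightarrow> int ell2 \<Rightarrow> int ell2" is "\<lambda>k f n. f (n + k)"
proof -
  fix k :: int and f :: "int \<Rightarrow> complex"
  assume "(\<lambda>n. (cmod (f n))\<^sup>2) summable_on UNIV"
  then show "(\<lambda>n. (cmod (f (n + k)))\<^sup>2) summable_on UNIV"
    using summable_shift[of "Abs_ell2 f" k] by (simp add: Abs_ell2_inverse)
qed

lemma norm_shift: "norm (shift k f) = norm f"
proof -
  have "(norm (shift k f))\<^sup>2 = (norm f)\<^sup>2"
    by (simp add: norm_ell2_power2[of "shift k f"] shift.rep_eq infsum_shift)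
  then show ?thesis
    by simp
qed

lemma shift_shift: "shift k (shift l f) = shift (k + l) f"
  by (simp add: ell2_eq_iff shift.rep_eq add.assoc)

lemma shift_0: "shift 0 f = f"
  by (simp add: ell2_eq_iff shift.rep_eq)

lemma shift_diff: "shift k (f - g) = shift k f - shift k g"
  by (simp add: ell2_eq_iff shift.rep_eq minus_ell2.rep_eq)

lemma bounded_linear_shift: "bounded_linear (shift k)"
  by (rule bounded_linear_intro[where K = 1])
    (simp_all add: ell2_eq_iff shift.rep_eq plus_ell2.rep_eq scaleR_ell2.rep_eq norm_shift)

lemma inj_shift: "inj (shift k)"
  by (rule inj_on_inverseI[where g = "shift (- k)"]) (simp add: shift_shift shift_0)

lemma norm_hop_op_diff_shift_le:
  assumes "c \<in> Omega \<sigma>" "0 \<le> \<sigma>"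
  shows "norm (hop_op c f - shift 1 f) \<le> \<sigma> * norm f"
proof -
  have c: "\<bar>c n\<bar> = \<sigma>" for n
    using assms by (auto simp: Omega_def dest!: spec[of _ n])
  have "norm (hop_op c f - shift 1 f) \<le> \<sigma> * norm (shift (- 1) f)"
    by (rule norm_ell2_le_pointwise)
      (simp_all add: assms Rep_ell2_diff Rep_hop_op[OF assms(1)] shift.rep_eq norm_mult c)
  then show ?thesis
    by (simp add: norm_shift)
qed

lemma norm_hop_op_le:
  assumes "c \<in> Omega \<sigma>" "0 \<le> \<sigma>"
  shows "norm (hop_op c f) \<le> (1 + \<sigma>) * norm f"
  using norm_hop_op_diff_shift_le[OF assms, of f] norm_triangle_ineq[of "hop_op c f - shift 1 f" "shift 1 f"]
  by (simp add: norm_shift algebra_simps)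

lemma spectrum_hop_op_cmod_le:
  assumes c: "c \<in> Omega \<sigma>" and "0 \<le> \<sigma>" and z: "z \<in> spectrum (hop_op c)"
  shows "cmod z \<le> 1 + \<sigma>"
proof (rule ccontr)
  assume "\<not> ?thesis"
  then have "1 + \<sigma> < cmod z" "z \<noteq> 0"
    using \<open>0 \<le> \<sigma>\<close> by auto
  \<comment> \<open>far from the origin, \<open>- 1 / z\<close> approximates the resolvent\<close>
  have "z \<notin> spectrum (hop_op c)"
  proof (rule not_in_spectrum_if_approx_inverse[OF bounded_clinear_hop_op[OF c]])
    show "bounded_linear (\<lambda>f. (- inverse z) *\<^sub>C f)"
      by (rule bounded_linear_scaleC)
    show "inj (\<lambda>f. (- inverse z) *\<^sub>C f)"
      using \<open>z \<noteq> 0\<close> by (intro inj_scaleC) simp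
    show "(1 + \<sigma>) / cmod z < 1"
      using \<open>1 + \<sigma> < cmod z\<close> \<open>z \<noteq> 0\<close> by (simp add: divide_simps)
    fix f
    have eq: "f - (- inverse z) *\<^sub>C (hop_op c f - z *\<^sub>C f) = inverse z *\<^sub>C hop_op c f"
      using \<open>z \<noteq> 0\<close> by (simp add: ell2_eq_iff scaleC.rep_eq minus_ell2.rep_eq algebra_simps)
    show "norm (f - (- inverse z) *\<^sub>C (hop_op c f - z *\<^sub>C f)) \<le> (1 + \<sigma>) / cmod z * norm f"
      unfolding eq norm_scaleC norm_inverse
      using norm_hop_op_le[OF c \<open>0 \<le> \<sigma>\<close>, of f] \<open>z \<noteq> 0\<close> by (simp add: divide_simps)
  qed
  with z show False
    by contradiction
qed

lemma spectrum_hop_op_cmod_ge: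
  assumes c: "c \<in> Omega \<sigma>" and "0 \<le> \<sigma>" and z: "z \<in> spectrum (hop_op c)"
  shows "1 - \<sigma> \<le> cmod z"
proof (rule ccontr)
  assume small: "\<not> ?thesis"
  \<comment> \<open>near the origin, the inverse of the unitary term of \<open>hop_op c\<close> approximates the resolvent\<close>
  have "z \<notin> spectrum (hop_op c)"
  proof (rule not_in_spectrum_if_approx_inverse[OF bounded_clinear_hop_op[OF c]])
    show "bounded_linear (shift (- 1))" "inj (shift (- 1))"
      by (rule bounded_linear_shift inj_shift)+
    show "\<sigma> + cmod z < 1"
      using small by simp
    fix f
    have "f - shift (- 1) (hop_op c f - z *\<^sub>C f)
        = shift (- 1) (z *\<^sub>C f - (hop_op c f - shift 1 f))"
      by (simp add: shift_diff shift_shift shift_0)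
    then have "norm (f - shift (- 1) (hop_op c f - z *\<^sub>C f))
        = norm (z *\<^sub>C f - (hop_op c f - shift 1 f))"
      by (simp add: norm_shift)
    also have "\<dots> \<le> cmod z * norm f + \<sigma> * norm f"
      by (rule order_trans[OF norm_triangle_ineq4])
        (simp add: norm_scaleC norm_hop_op_diff_shift_le[OF c \<open>0 \<le> \<sigma>\<close>])
    finally show "norm (f - shift (- 1) (hop_op c f - z *\<^sub>C f)) \<le> (\<sigma> + cmod z) * norm f"
      by (simp add: algebra_simps)
  qed
  with z show False
    by contradiction
qed

text \<open>
  Pairing the two hops across one bond gives \<open>c w + cnj w\<close> with \<open>w = a cnj b\<close>; it has real part
  \<open>(1 + c) Re w\<close> and imaginary part \<open>(c - 1) Im w\<close>. The Cauchy-Schwarz inequality in the plane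
  bounds the sum of their absolute values by \<open>\<bar>w\<bar> \<surd>((1 + c)\<^sup>2 + (1 - c)\<^sup>2)\<close>, which no longer depends
  on the sign of \<open>c\<close>. The signs \<open>s\<close> and \<open>t\<close> stand for the two absolute values: the factor
  \<open>s - \<i> t\<close> turns the real part into \<open>s\<close> times the real plus \<open>t\<close> times the imaginary part.
\<close>

lemma bond_form_le:
  fixes a b :: complex and c s t :: real
  assumes "\<bar>s\<bar> = 1" "\<bar>t\<bar> = 1"
  shows "inner (Complex s (- t) * (complex_of_real c * a)) b + inner (Complex s (- t) * b) a
    \<le> sqrt (2 * (1 + c\<^sup>2)) / 2 * ((cmod a)\<^sup>2 + (cmod b)\<^sup>2)"
proof -
  define w where "w = a * cnj b"
  have st: "s\<^sup>2 = 1" "t\<^sup>2 = 1"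
    using assms by (metis power2_abs power_one)+
  have "inner (Complex s (- t) * (complex_of_real c * a)) b + inner (Complex s (- t) * b) a
      = inner (Complex (s * (1 + c)) (t * (c - 1))) w"
    by (simp add: w_def inner_complex_def algebra_simps)
  also have "\<dots> \<le> cmod (Complex (s * (1 + c)) (t * (c - 1))) * cmod w"
    by (rule norm_cauchy_schwarz)
  also have "cmod (Complex (s * (1 + c)) (t * (c - 1))) = sqrt (2 * (1 + c\<^sup>2))"
    by (simp add: complex_norm power_mult_distrib st)
      (simp add: power2_eq_square algebra_simps)
  also have "sqrt (2 * (1 + c\<^sup>2)) * cmod w
      \<le> sqrt (2 * (1 + c\<^sup>2)) * (((cmod a)\<^sup>2 + (cmod b)\<^sup>2) / 2)"
    using sum_squares_bound[of "cmod a" "cmod b"]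
    by (intro mult_left_mono) (simp_all add: w_def norm_mult)
  finally show ?thesis
    by simp
qed

lemma inner_hop_op_le:
  assumes c: "c \<in> Omega \<sigma>" and st: "\<bar>s\<bar> = 1" "\<bar>t\<bar> = 1"
  shows "inner (Complex s (- t) *\<^sub>C hop_op c f) f \<le> sqrt (2 * (1 + \<sigma>\<^sup>2)) * (norm f)\<^sup>2"
proof -
  define u where "u = Complex s (- t)"
  define r where "r = sqrt (2 * (1 + \<sigma>\<^sup>2)) / 2"
  let ?F = "Rep_ell2 f"
  let ?L = "Rep_ell2 (u *\<^sub>C (hop_op c f - shift 1 f))" and ?R = "Rep_ell2 (u *\<^sub>C shift 1 f)"
  have c2: "(c n)\<^sup>2 = \<sigma>\<^sup>2" for n
    using c by (auto simp: Omega_def dest!: spec[of _ n])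
  have bij: "bij_betw (\<lambda>n::int. n + - 1) UNIV UNIV"
    by (rule bij_betwI[where g = "\<lambda>n. n + 1"]) auto
  have L: "?L n = u * (complex_of_real (c n) * ?F (n + - 1))" for n
    by (simp add: scaleC.rep_eq Rep_ell2_diff Rep_hop_op[OF c] shift.rep_eq)
  have R: "?R (n + - 1) = u * ?F n" for n
    by (simp add: scaleC.rep_eq shift.rep_eq)
  have sumL: "(\<lambda>n. inner (?L n) (?F n)) summable_on UNIV"
    and sumR: "(\<lambda>n. inner (?R n) (?F n)) summable_on UNIV"
    by (intro square_summable_inner ell2_summable)+
  \<comment> \<open>reindexing the second family so that both hops across the same bond meet\<close>
  have sumR': "(\<lambda>n. inner (?R (n + - 1)) (?F (n + - 1))) summable_on UNIV"
    using sumR summable_on_reindex_bij_betw[OF bij, of "\<lambda>n. inner (?R n) (?F n)"] by blast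
  have "inner (u *\<^sub>C hop_op c f) f
      = inner (u *\<^sub>C (hop_op c f - shift 1 f)) f + inner (u *\<^sub>C shift 1 f) f"
    by (simp add: scaleC_diff_right inner_diff_left)
  also have "\<dots> = (\<Sum>\<^sub>\<infinity>n. inner (?L n) (?F n)) + (\<Sum>\<^sub>\<infinity>n. inner (?R (n + - 1)) (?F (n + - 1)))"
    unfolding inner_ell2.rep_eq
    using infsum_reindex_bij_betw[OF bij, of "\<lambda>n. inner (?R n) (?F n)"] by presburger
  also have "\<dots> = (\<Sum>\<^sub>\<infinity>n. inner (?L n) (?F n) + inner (?R (n + - 1)) (?F (n + - 1)))"
    by (rule infsum_add[symmetric, OF sumL sumR'])
  also have "\<dots> \<le> (\<Sum>\<^sub>\<infinity>n. r * ((cmod (?F (n + - 1)))\<^sup>2 + (cmod (?F n))\<^sup>2))"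
  proof (rule infsum_mono)
    show "(\<lambda>n. inner (?L n) (?F n) + inner (?R (n + - 1)) (?F (n + - 1))) summable_on UNIV"
      by (rule summable_on_add[OF sumL sumR'])
    show "(\<lambda>n. r * ((cmod (?F (n + - 1)))\<^sup>2 + (cmod (?F n))\<^sup>2)) summable_on UNIV"
      by (intro summable_on_cmult_right summable_on_add summable_shift ell2_summable)
    show "inner (?L n) (?F n) + inner (?R (n + - 1)) (?F (n + - 1))
        \<le> r * ((cmod (?F (n + - 1)))\<^sup>2 + (cmod (?F n))\<^sup>2)" for n
      unfolding L R unfolding r_def u_def c2[of n, symmetric] by (rule bond_form_le[OF st])
  qed
  also have "\<dots> = r * ((norm f)\<^sup>2 + (norm f)\<^sup>2)"
    by (simp add: infsum_cmult_right' infsum_add[OF summable_shift ell2_summable]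
        infsum_shift norm_ell2_power2[symmetric] del: add_uminus_conv_diff)
  finally show ?thesis
    by (simp add: r_def u_def)
qed

lemma spectrum_hop_op_l1_le:
  assumes c: "c \<in> Omega \<sigma>" and z: "z \<in> spectrum (hop_op c)"
  shows "\<bar>Re z\<bar> + \<bar>Im z\<bar> \<le> sqrt (2 * (1 + \<sigma>\<^sup>2))"
proof (rule ccontr)
  assume large: "\<not> ?thesis"
  \<comment> \<open>\<open>Re (u z) = \<bar>Re z\<bar> + \<bar>Im z\<bar>\<close> for \<open>u = s - \<i> t\<close>: the normal of the side of the square facing \<open>z\<close>\<close>
  define s :: real where "s = (if 0 \<le> Re z then 1 else - 1)"
  define t :: real where "t = (if 0 \<le> Im z then 1 else - 1)"
  define u where "u = Complex s (- t)"
  have st: "\<bar>s\<bar> = 1" "\<bar>t\<bar> = 1"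
    by (simp_all add: s_def t_def)
  have Re_uz: "Re (u * z) = \<bar>Re z\<bar> + \<bar>Im z\<bar>"
    by (simp add: u_def s_def t_def)
  have "z \<notin> spectrum (hop_op c)"
  proof (rule not_in_spectrum_if_coercive[OF bounded_clinear_hop_op[OF c]])
    show "0 < \<bar>Re z\<bar> + \<bar>Im z\<bar> - sqrt (2 * (1 + \<sigma>\<^sup>2))"
      using large by simp
    show "u \<noteq> 0"
      using st by (auto simp: u_def complex_eq_iff)
    fix f :: "int ell2"
    have pt: "inner (u * z * x) x = Re (u * z) * (cmod x)\<^sup>2" for x
      unfolding cmod_power2 by (simp add: inner_complex_def power2_eq_square algebra_simps)
    have "inner ((u * z) *\<^sub>C f) f = (\<bar>Re z\<bar> + \<bar>Im z\<bar>) * (norm f)\<^sup>2"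
      unfolding inner_ell2.rep_eq scaleC.rep_eq pt norm_ell2_power2 Re_uz
      by (rule infsum_cmult_right')
    then show "(\<bar>Re z\<bar> + \<bar>Im z\<bar> - sqrt (2 * (1 + \<sigma>\<^sup>2))) * (norm f)\<^sup>2
        \<le> inner (u *\<^sub>C (z *\<^sub>C f - hop_op c f)) f"
      using inner_hop_op_le[OF c st, of f]
      by (simp add: scaleC_diff_right scaleC_scaleC inner_diff_left left_diff_distrib u_def)
  qed
  with z show False
    by contradiction
qed

theorem lemma26:
  fixes \<sigma> :: real
  assumes "0 < \<sigma>" and "\<sigma> \<le> 1"
  shows "\<forall>c\<in>Omega \<sigma>.
    spectrum (hop_op c) \<subseteq> {z. 1 - \<sigma> \<le> cmod z \<and> cmod z \<le> 1 + \<sigma>} \<and>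
    spectrum (hop_op c) \<subseteq> {Complex x y | x y. \<bar>x\<bar> + \<bar>y\<bar> \<le> sqrt (2 * (1 + \<sigma>\<^sup>2))}"
proof (intro ballI conjI subsetI)
  fix c z
  assume cz: "c \<in> Omega \<sigma>" "z \<in> spectrum (hop_op c)"
  show "z \<in> {z. 1 - \<sigma> \<le> cmod z \<and> cmod z \<le> 1 + \<sigma>}"
    using spectrum_hop_op_cmod_ge spectrum_hop_op_cmod_le cz assms by simp
  have "z = Complex (Re z) (Im z)"
    by simp
  then show "z \<in> {Complex x y | x y. \<bar>x\<bar> + \<bar>y\<bar> \<le> sqrt (2 * (1 + \<sigma>\<^sup>2))}"
    using spectrum_hop_op_l1_le[OF cz] by blast
qed

end
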